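(* Let $0<\theta<\infty$. Let $V(\boldsymbol a)=\sum_{n=1}^N U_n(\boldsymbol a)$, let $\overline{\boldsymbol a}\in\arg\max_{\boldsymbol a\in\Omega}V(\boldsymbol a)$, and let $V_\theta=\sum_{\boldsymbol a\in\Omega}q^*_{\boldsymbol a}V(\boldsymbol a)$, where $q^*_{\boldsymbol a}=\exp(\theta\Phi(\boldsymbol a))/\sum_{\hat{\boldsymbol a}\in\Omega}\exp(\theta\Phi(\hat{\boldsymbol a}))$ is the stationary distribution of the distributed spectrum access algorithm with parameter $\theta$. Then the performance gap $\rho_\theta=V(\overline{\boldsymbol a})-V_\theta$ satisfies $$\rho_\theta\le\frac1\theta\sum_{n=1}^N\ln|\mathcal M_n|+\frac12\sum_{n=1}^N\sum_{m\in\mathcal N_n^{sp}}(1-w_{nm})P_m d_{mn}^{-\alpha}+\frac12\sum_{n=1}^N\sum_{m\in\mathcal N_n^p\setminus\mathcal N_n^{sp}}P_m d_{mn}^{-\alpha}.$$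
   Context: Users: $\mathcal N=\{1,\dots,N\}$. User $n$ chooses a channel $a_n$ from a nonempty finite set $\mathcal M_n$ of vacant channels; $\boldsymbol a\in\Omega=\prod_n\mathcal M_n$. $P_m>0$ is the transmission power of user $m$, $d_{mn}=d_{nm}>0$ is the distance between $m\ne n$, $\alpha>0$ is the path loss factor, $\omega^n_a\in\mathbb R$ is the noise power of user $n$ on channel $a$, and $I_{\{\cdot\}}$ is the indicator. Physical and social graphs on $\mathcal N$ (no loops) have neighbour sets $\mathcal N_n^p$ and $\mathcal N_n^s$; $\mathcal N_n^{sp}=\mathcal N_n^p\cap\mathcal N_n^s$; social ties have strengths $w_{nm}\in[0,1]$. Standing assumptions: equal powers ($P_n=P_m$), both graphs undirected, $w_{nm}=w_{mn}$. Individual utility: $U_n(\boldsymbol a)=-\sum_{m\in\mathcal N_n^p}P_m d_{mn}^{-\alpha}I_{\{a_n=a_m\}}-\omega^n_{a_n}$. Potential function: $$\Phi(\boldsymbol a)=-\frac12\sum_{n}\sum_{m\in\mathcal N_n^p}P_m d_{mn}^{-\alpha}I_{\{a_n=a_m\}}-\sum_n\omega^n_{a_n}-\frac12\sum_n\sum_{m\in\mathcal N_n^{sp}}w_{nm}P_m d_{mn}^{-\alpha}I_{\{a_n=a_m\}}.$$ The distributed spectrum access algorithm enters the statement only through its stationary distribution $\boldsymbol q^*$. *)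

theory Defs
  imports Complex_Main "HOL-Library.FuncSet"
begin

definition users :: "nat \<Rightarrow> nat set" where
  "users N = {1..N}"

text \<open>An undirected loopless graph on \<open>V\<close>, given by its adjacency relation.\<close>

definition undirected_graph :: "nat set \<Rightarrow> (nat \<times> nat) set \<Rightarrow> bool" where
  "undirected_graph V E \<longleftrightarrow> E \<subseteq> V \<times> V \<and> irrefl E \<and> sym E"

definition nbrs :: "(nat \<times> nat) set \<Rightarrow> nat \<Rightarrow> nat set" where
  "nbrs E n = E `` {n}"

text \<open>Profiles are extensional functions (\<open>undefined\<close> outside the user set), so that the
  set of profiles is finite.\<close>

definition profiles :: "nat \<Rightarrow> (nat \<Rightarrow> 'c set) \<Rightarrow> (nat \<Rightarrow> 'c) set" where
  "profiles N M = (\<Pi>\<^sub>E n\<in>users N. M n)"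

text \<open>Parameters: \<open>Ep\<close>, \<open>Es\<close> are the physical and the social graph, \<open>P\<close> the powers,
  \<open>d\<close> the distances, \<open>\<alpha>\<close> the path loss factor, \<open>\<omega> n c\<close> the noise power of user \<open>n\<close>
  on channel \<open>c\<close>, \<open>w\<close> the social tie strengths.\<close>

definition utility ::
  "(nat \<times> nat) set \<Rightarrow> (nat \<Rightarrow> real) \<Rightarrow> (nat \<Rightarrow> nat \<Rightarrow> real) \<Rightarrow> real \<Rightarrow>
   (nat \<Rightarrow> 'c \<Rightarrow> real) \<Rightarrow> nat \<Rightarrow> (nat \<Rightarrow> 'c) \<Rightarrow> real" where
  "utility Ep P d \<alpha> \<omega> n a =
     - (\<Sum>m\<in>nbrs Ep n. P m * d m n powr (- \<alpha>) * of_bool (a n = a m)) - \<omega> n (a n)"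

definition total_utility ::
  "nat \<Rightarrow> (nat \<times> nat) set \<Rightarrow> (nat \<Rightarrow> real) \<Rightarrow> (nat \<Rightarrow> nat \<Rightarrow> real) \<Rightarrow> real \<Rightarrow>
   (nat \<Rightarrow> 'c \<Rightarrow> real) \<Rightarrow> (nat \<Rightarrow> 'c) \<Rightarrow> real" where
  "total_utility N Ep P d \<alpha> \<omega> a = (\<Sum>n\<in>users N. utility Ep P d \<alpha> \<omega> n a)"

definition potential ::
  "nat \<Rightarrow> (nat \<times> nat) set \<Rightarrow> (nat \<times> nat) set \<Rightarrow> (nat \<Rightarrow> real) \<Rightarrow> (nat \<Rightarrow> nat \<Rightarrow> real) \<Rightarrow> real \<Rightarrow>
   (nat \<Rightarrow> 'c \<Rightarrow> real) \<Rightarrow> (nat \<Rightarrow> nat \<Rightarrow> real) \<Rightarrow> (nat \<Rightarrow> 'c) \<Rightarrow> real" where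
  "potential N Ep Es P d \<alpha> \<omega> w a =
     - (1/2) * (\<Sum>n\<in>users N. \<Sum>m\<in>nbrs Ep n.
          P m * d m n powr (- \<alpha>) * of_bool (a n = a m))
     - (\<Sum>n\<in>users N. \<omega> n (a n))
     - (1/2) * (\<Sum>n\<in>users N. \<Sum>m\<in>nbrs Ep n \<inter> nbrs Es n.
          w n m * P m * d m n powr (- \<alpha>) * of_bool (a n = a m))"

text \<open>The Gibbs distribution on a finite set \<open>\<Omega>\<close> with potential \<open>\<Phi>\<close>, which is the stationary
  distribution of the distributed spectrum access algorithm with parameter \<open>\<theta>\<close>.\<close>

definition gibbs :: "'s set \<Rightarrow> real \<Rightarrow> ('s \<Rightarrow> real) \<Rightarrow> 's \<Rightarrow> real" where
  "gibbs \<Omega> \<theta> \<Phi> a = exp (\<theta> * \<Phi> a) / (\<Sum>b\<in>\<Omega>. exp (\<theta> * \<Phi> b))"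

definition expected_total_utility ::
  "nat \<Rightarrow> (nat \<Rightarrow> 'c set) \<Rightarrow> (nat \<times> nat) set \<Rightarrow> (nat \<times> nat) set \<Rightarrow> (nat \<Rightarrow> real) \<Rightarrow>
   (nat \<Rightarrow> nat \<Rightarrow> real) \<Rightarrow> real \<Rightarrow> (nat \<Rightarrow> 'c \<Rightarrow> real) \<Rightarrow> (nat \<Rightarrow> nat \<Rightarrow> real) \<Rightarrow> real \<Rightarrow> real" where
  "expected_total_utility N M Ep Es P d \<alpha> \<omega> w \<theta> =
     (\<Sum>a\<in>profiles N M.
        gibbs (profiles N M) \<theta> (potential N Ep Es P d \<alpha> \<omega> w) a * total_utility N Ep P d \<alpha> \<omega> a)"

end

theory Submission
  imports Defs
begin

text \<open>
  Since all coefficients are nonnegative, the potential \<open>\<Phi>\<close> exceeds the total utility \<open>V\<close> pointwise by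
  a quantity between 0 and the two graph-dependent terms \<open>C\<close> of the bound. The Gibbs distribution
  maximises mean potential plus \<open>1/\<theta>\<close> times entropy, with optimal value \<open>(1/\<theta>) ln Z \<ge> max \<Phi>\<close>, and its
  entropy is at most \<open>ln |\<Omega>|\<close>. Hence
  \<open>V abar \<le> \<Phi> abar \<le> E \<Phi> + (1/\<theta>) ln |\<Omega>| \<le> E V + C + (1/\<theta>) ln |\<Omega>|\<close>.
\<close>

lemma sum_gibbs:
  assumes "finite \<Omega>" "\<Omega> \<noteq> {}"
  shows "(\<Sum>a\<in>\<Omega>. gibbs \<Omega> \<theta> \<Phi> a) = 1"
proof -
  have "(\<Sum>b\<in>\<Omega>. exp (\<theta> * \<Phi> b)) > 0"
    using assms by (intro sum_pos) auto
  then show ?thesis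
    by (simp add: gibbs_def flip: sum_divide_distrib)
qed

lemma gibbs_pos:
  assumes "finite \<Omega>" "\<Omega> \<noteq> {}"
  shows "gibbs \<Omega> \<theta> \<Phi> a > 0"
  unfolding gibbs_def using assms by (intro divide_pos_pos sum_pos) auto

text \<open>This is Gibbs' inequality against the uniform distribution:
  \<open>ln x \<le> x - 1\<close> is applied to the ratio of the uniform weight \<open>1 / K\<close>
  to \<open>q a\<close>, weighted by \<open>q a\<close> and summed. Strict positivity of
  \<open>q\<close> permits the division.\<close>

lemma entropy_le_ln_card:
  fixes q :: "'s \<Rightarrow> real"
  assumes "finite \<Omega>" and pos: "\<And>a. a \<in> \<Omega> \<Longrightarrow> q a > 0" and one: "(\<Sum>a\<in>\<Omega>. q a) = 1"
  shows "(\<Sum>a\<in>\<Omega>. - (q a * ln (q a))) \<le> ln (card \<Omega>)"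
proof -
  define K where "K = real (card \<Omega>)"
  have K: "K > 0"
    using assms by (auto simp: K_def card_gt_0_iff)
  have "- (q a * ln (q a)) \<le> 1 / K - q a + q a * ln K" if "a \<in> \<Omega>" for a
  proof -
    have "ln (1 / (q a * K)) \<le> 1 / (q a * K) - 1"
      using pos[OF that] K by (intro ln_le_minus_one) auto
    then have "q a * ln (1 / (q a * K)) \<le> q a * (1 / (q a * K) - 1)"
      using pos[OF that] by (intro mult_left_mono) auto
    moreover have "ln (1 / (q a * K)) = - ln (q a) - ln K"
      using pos[OF that] K by (simp add: ln_div ln_mult)
    moreover have "q a * (1 / (q a * K) - 1) = 1 / K - q a"
      using pos[OF that] by (simp add: right_diff_distrib)
    ultimately show ?thesis
      by (simp add: right_diff_distrib)
  qed
  then have "(\<Sum>a\<in>\<Omega>. - (q a * ln (q a))) \<le> (\<Sum>a\<in>\<Omega>. 1 / K - q a + q a * ln K)"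
    by (rule sum_mono)
  \<comment> \<open>The \<open>K\<close> copies of \<open>1 / K\<close> and the weights
    \<open>q a\<close> both total 1 and cancel, so only the average of the constant
    \<open>ln K\<close> survives.\<close>
  also have "\<dots> = ln K"
    using K one by (simp add: sum.distrib sum_subtractf K_def flip: sum_distrib_right)
  finally show ?thesis
    by (simp add: K_def)
qed

text \<open>\<open>Z\<close> dominates its own summand at \<open>x\<close>, so
  \<open>\<theta> * \<Phi> x \<le> ln Z\<close>. Since \<open>ln q\<close> is
  \<open>\<theta> * \<Phi>\<close> shifted by \<open>ln Z\<close>, averaging over \<open>q\<close>
  splits \<open>ln Z\<close> into \<open>\<theta>\<close> times the mean of \<open>\<Phi>\<close>
  and the entropy of \<open>q\<close>.\<close>

lemma le_gibbs_mean_plus_ln_card: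
  assumes fin: "finite \<Omega>" and x: "x \<in> \<Omega>" and \<theta>: "\<theta> > 0"
  shows "\<Phi> x \<le> (\<Sum>a\<in>\<Omega>. gibbs \<Omega> \<theta> \<Phi> a * \<Phi> a) + (1 / \<theta>) * ln (card \<Omega>)"
proof -
  define Z where "Z = (\<Sum>b\<in>\<Omega>. exp (\<theta> * \<Phi> b))"
  define q where "q = gibbs \<Omega> \<theta> \<Phi>"
  have ne: "\<Omega> \<noteq> {}"
    using x by auto
  have Z: "Z > 0"
    unfolding Z_def using fin ne by (intro sum_pos) auto
  have one: "(\<Sum>a\<in>\<Omega>. q a) = 1"
    unfolding q_def using fin ne by (rule sum_gibbs)
  have "exp (\<theta> * \<Phi> x) \<le> Z"
    unfolding Z_def using fin x by (intro member_le_sum) auto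
  then have "\<theta> * \<Phi> x \<le> ln Z"
    using Z by (simp add: ln_ge_iff)
  \<comment> \<open>The constant is written as an average so that it can be expanded summand by
    summand.\<close>
  also have "ln Z = (\<Sum>a\<in>\<Omega>. q a * ln Z)"
    using one by (simp flip: sum_distrib_right)
  also have "\<dots> = (\<Sum>a\<in>\<Omega>. \<theta> * (q a * \<Phi> a) + - (q a * ln (q a)))"
  proof (rule sum.cong)
    fix a
    have ln_q: "ln (q a) = \<theta> * \<Phi> a - ln Z"
      using Z by (simp add: q_def gibbs_def ln_div flip: Z_def)
    show "q a * ln Z = \<theta> * (q a * \<Phi> a) + - (q a * ln (q a))"
      unfolding ln_q by (simp add: algebra_simps)
  qed simp
  also have "\<dots> = \<theta> * (\<Sum>a\<in>\<Omega>. q a * \<Phi> a) + (\<Sum>a\<in>\<Omega>. - (q a * ln (q a)))"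
    by (simp only: sum.distrib sum_distrib_left)
  also have "\<dots> \<le> \<theta> * (\<Sum>a\<in>\<Omega>. q a * \<Phi> a) + ln (card \<Omega>)"
    using entropy_le_ln_card[OF fin, of q] gibbs_pos[OF fin ne] one by (simp add: q_def)
  finally show ?thesis
    using \<theta> by (simp add: q_def field_simps)
qed

lemma finite_nbrs:
  assumes "undirected_graph (users N) E"
  shows "finite (nbrs E n)"
proof (rule finite_subset)
  show "nbrs E n \<subseteq> users N"
    using assms by (auto simp: undirected_graph_def nbrs_def)
qed (simp add: users_def)

text \<open>The noise terms cancel. A physical link has weight -1 in the total utility; in the
  potential it has weight -1/2, and a further \<open>- w n m / 2\<close> if it is also social. The
  difference is thus \<open>(1 - w n m) / 2\<close> on shared links and 1/2 on purely physical
  ones.\<close>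

lemma potential_minus_total_utility:
  assumes "undirected_graph (users N) Ep"
  shows "potential N Ep Es P d \<alpha> \<omega> w a - total_utility N Ep P d \<alpha> \<omega> a =
    (1/2) * (\<Sum>n\<in>users N. \<Sum>m\<in>nbrs Ep n \<inter> nbrs Es n.
        (1 - w n m) * P m * d m n powr (- \<alpha>) * of_bool (a n = a m))
    + (1/2) * (\<Sum>n\<in>users N. \<Sum>m\<in>nbrs Ep n - (nbrs Ep n \<inter> nbrs Es n).
        P m * d m n powr (- \<alpha>) * of_bool (a n = a m))"
proof -
  define g where "g n m = P m * d m n powr (- \<alpha>) * of_bool (a n = a m)" for n m
  have nbrs_split: "(\<Sum>m\<in>nbrs Ep n. g n m) =
      (\<Sum>m\<in>nbrs Ep n - (nbrs Ep n \<inter> nbrs Es n). g n m) + (\<Sum>m\<in>nbrs Ep n \<inter> nbrs Es n. g n m)" for n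
    by (rule sum.subset_diff) (auto simp: finite_nbrs[OF assms])
  have "potential N Ep Es P d \<alpha> \<omega> w a - total_utility N Ep P d \<alpha> \<omega> a =
      (1/2) * (\<Sum>n\<in>users N. \<Sum>m\<in>nbrs Ep n. g n m)
      - (1/2) * (\<Sum>n\<in>users N. \<Sum>m\<in>nbrs Ep n \<inter> nbrs Es n. w n m * g n m)"
    by (simp add: potential_def total_utility_def utility_def g_def sum_subtractf sum_negf mult.assoc)
  also have "\<dots> = (1/2) * (\<Sum>n\<in>users N. \<Sum>m\<in>nbrs Ep n \<inter> nbrs Es n. (1 - w n m) * g n m)
      + (1/2) * (\<Sum>n\<in>users N. \<Sum>m\<in>nbrs Ep n - (nbrs Ep n \<inter> nbrs Es n). g n m)"
    unfolding nbrs_split by (simp add: sum.distrib sum_subtractf algebra_simps)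
  finally show ?thesis
    by (simp add: g_def mult.assoc)
qed

theorem theorem5:
  fixes N :: nat
    and M :: "nat \<Rightarrow> 'c set"
    and Ep Es :: "(nat \<times> nat) set"
    and P :: "nat \<Rightarrow> real"
    and d :: "nat \<Rightarrow> nat \<Rightarrow> real"
    and \<alpha> :: real
    and \<omega> :: "nat \<Rightarrow> 'c \<Rightarrow> real"
    and w :: "nat \<Rightarrow> nat \<Rightarrow> real"
    and \<theta> :: real
    and abar :: "nat \<Rightarrow> 'c"
  assumes "\<And>n. n \<in> users N \<Longrightarrow> finite (M n) \<and> M n \<noteq> {}"
    and "undirected_graph (users N) Ep"
    and "undirected_graph (users N) Es"
    and "\<And>n. n \<in> users N \<Longrightarrow> P n > 0"
    and "\<And>n m. n \<in> users N \<Longrightarrow> m \<in> users N \<Longrightarrow> P n = P m"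
    and "\<And>n m. n \<in> users N \<Longrightarrow> m \<in> users N \<Longrightarrow> m \<noteq> n \<Longrightarrow> d m n > 0 \<and> d m n = d n m"
    and "\<alpha> > 0"
    and "\<And>n m. (n, m) \<in> Es \<Longrightarrow> 0 \<le> w n m \<and> w n m \<le> 1 \<and> w n m = w m n"
    and "\<theta> > 0"
    and "is_arg_max (total_utility N Ep P d \<alpha> \<omega>) (\<lambda>a. a \<in> profiles N M) abar"
  shows "total_utility N Ep P d \<alpha> \<omega> abar - expected_total_utility N M Ep Es P d \<alpha> \<omega> w \<theta>
    \<le> (1 / \<theta>) * (\<Sum>n\<in>users N. ln (real (card (M n))))
      + (1/2) * (\<Sum>n\<in>users N. \<Sum>m\<in>nbrs Ep n \<inter> nbrs Es n. (1 - w n m) * P m * d m n powr (- \<alpha>))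
      + (1/2) * (\<Sum>n\<in>users N. \<Sum>m\<in>nbrs Ep n - (nbrs Ep n \<inter> nbrs Es n). P m * d m n powr (- \<alpha>))"
proof -
  define \<Omega> where "\<Omega> = profiles N M"
  define \<Phi> where "\<Phi> = potential N Ep Es P d \<alpha> \<omega> w"
  define V where "V = total_utility N Ep P d \<alpha> \<omega>"
  define q where "q = gibbs \<Omega> \<theta> \<Phi>"
  define C where "C =
      (1/2) * (\<Sum>n\<in>users N. \<Sum>m\<in>nbrs Ep n \<inter> nbrs Es n. (1 - w n m) * P m * d m n powr (- \<alpha>))
      + (1/2) * (\<Sum>n\<in>users N. \<Sum>m\<in>nbrs Ep n - (nbrs Ep n \<inter> nbrs Es n). P m * d m n powr (- \<alpha>))"
  have fin: "finite \<Omega>"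
    unfolding \<Omega>_def profiles_def using assms(1) by (intro finite_PiE) (auto simp: users_def)
  have abar: "abar \<in> \<Omega>"
    using assms(10) by (auto simp: is_arg_max_def \<Omega>_def)
  have card: "ln (real (card \<Omega>)) = (\<Sum>n\<in>users N. ln (real (card (M n))))"
  proof -
    have "real (card \<Omega>) = (\<Prod>n\<in>users N. real (card (M n)))"
      by (simp add: \<Omega>_def profiles_def card_PiE users_def)
    also have "ln \<dots> = (\<Sum>n\<in>users N. ln (real (card (M n))))"
      using assms(1) by (intro ln_prod) (auto simp: users_def card_gt_0_iff)
    finally show ?thesis .
  qed
  \<comment> \<open>Edges stay inside \<open>users N\<close>, so positivity of the powers reaches
    every neighbour; the \<open>powr\<close> factors are nonnegative in any case.\<close>
  have p_nonneg: "P m \<ge> 0" if "m \<in> nbrs Ep n" for m n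
    using assms(2,4) that by (force simp: undirected_graph_def nbrs_def)
  have w_le: "w n m \<le> 1" if "m \<in> nbrs Es n" for m n
    using assms(8)[of n m] that by (simp add: nbrs_def)
  have lower: "V a \<le> \<Phi> a" for a
  proof -
    have "0 \<le> \<Phi> a - V a"
      unfolding \<Phi>_def V_def potential_minus_total_utility[OF assms(2)]
      by (intro add_nonneg_nonneg mult_nonneg_nonneg sum_nonneg) (auto simp: p_nonneg w_le)
    then show ?thesis
      by simp
  qed
  \<comment> \<open>\<open>C\<close> is the difference formula with every indicator replaced by 1,
    which can only increase it because the coefficients are nonnegative.\<close>
  have upper: "\<Phi> a \<le> V a + C" for a
  proof -
    have "\<Phi> a - V a \<le> C"
      unfolding \<Phi>_def V_def potential_minus_total_utility[OF assms(2)] C_def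
      by (intro add_mono mult_left_mono sum_mono) (auto simp: p_nonneg w_le)
    then show ?thesis
      by simp
  qed
  have ne: "\<Omega> \<noteq> {}"
    using abar by auto
  have "(\<Sum>a\<in>\<Omega>. q a * \<Phi> a) \<le> (\<Sum>a\<in>\<Omega>. q a * (V a + C))"
    unfolding q_def by (intro sum_mono mult_left_mono upper less_imp_le gibbs_pos fin ne)
  \<comment> \<open>\<open>C\<close> does not depend on the profile and the weights sum to
    1.\<close>
  also have "\<dots> = (\<Sum>a\<in>\<Omega>. q a * V a) + C"
    using sum_gibbs[OF fin ne] by (simp add: q_def distrib_left sum.distrib flip: sum_distrib_right)
  also have "(\<Sum>a\<in>\<Omega>. q a * V a) = expected_total_utility N M Ep Es P d \<alpha> \<omega> w \<theta>"
    by (simp add: expected_total_utility_def q_def \<Omega>_def \<Phi>_def V_def)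
  finally have "V abar \<le> expected_total_utility N M Ep Es P d \<alpha> \<omega> w \<theta> + C + (1 / \<theta>) * ln (card \<Omega>)"
    using lower[of abar] le_gibbs_mean_plus_ln_card[OF fin abar assms(9), of \<Phi>]
    unfolding q_def by linarith
  then show ?thesis
    unfolding V_def C_def card by linarith
qed

end
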